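(* Let $(X_n)_{n\ge0}$ be a sequence generated by an $m$-letter, aperiodic, irreducible, homogeneous Markov chain with state space $\mathcal{A}_m=\{\alpha_1<\cdots<\alpha_m\}$, transition matrix $P$ and stationary distribution $(\pi_1,\dots,\pi_m)$, and let the law of $X_0$ be the stationary distribution. For $1\le r\le m$, let $T_k^r=a_k^r-\pi_rk$ for $k\ge1$ and $T_0^r=0$, where $a_k^r$ is the number of occurrences of $\alpha_r$ among $(X_i)_{1\le i\le k}$. Let $P=S^{-1}\Lambda S=S^{-1}\mathrm{diag}(1,\tilde\Lambda)S$ be the Jordan decomposition of $P$, where the rows of $S$ are generalized left eigenvectors of $P$, the first row of $S$ is $(\pi_1,\dots,\pi_m)$, and $\tilde\Lambda$ is the $(m-1)\times(m-1)$ (lower) Jordan-block matrix, and let $D=\mathrm{diag}(-1/2,\tilde\Lambda(I-\tilde\Lambda)^{-1})$. Then, for $1\le r\le m$, $$\lim_{k\to\infty}\frac{\mathrm{Var}\,T_k^r}{k}=\pi_r\left(1+2e_rS^{-1}DSe_r^T\right),$$ and for $r_1\ne r_2$, $$\lim_{k\to\infty}\frac{\mathrm{Cov}(T_k^{r_1},T_k^{r_2})}{k}=\pi_{r_1}e_{r_1}S^{-1}DSe_{r_2}^T+\pi_{r_2}e_{r_2}S^{-1}DSe_{r_1}^T.$$ That is, the asymptotic covariance matrix of $(T_k^1,\dots,T_k^m)$ is $$\Sigma=\Pi+\Pi(S^{-1}DS)+(S^{-1}DS)^T\Pi,\qquad \Pi=\mathrm{diag}(\pi_1,\dots,\pi_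m).$$
   Context: $e_r$ denotes the $r$-th standard basis (row) vector of $\mathbb{R}^m$. *)

theory Defs
  imports
    "HOL-Probability.Probability"
    "Jordan_Normal_Form.Jordan_Normal_Form"
    "Jordan_Normal_Form.Gauss_Jordan_Elimination"
begin

text \<open>
  Letters, states and matrix entries are indexed by \<open>0, \<dots>, m - 1\<close>, following the matrix library:
  the letter \<open>\<alpha> i\<close> is the \<open>(i + 1)\<close>-st smallest letter of the alphabet.
\<close>

definition stochastic_mat :: "nat \<Rightarrow> real mat \<Rightarrow> bool" where
  "stochastic_mat m P \<longleftrightarrow>
     P \<in> carrier_mat m m \<and>
     (\<forall>i<m. \<forall>j<m. 0 \<le> P $$ (i, j)) \<and>
     (\<forall>i<m. (\<Sum>j<m. P $$ (i, j)) = 1)"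

definition irreducible_chain :: "nat \<Rightarrow> real mat \<Rightarrow> bool" where
  "irreducible_chain m P \<longleftrightarrow> (\<forall>i<m. \<forall>j<m. \<exists>n. 0 < (P ^\<^sub>m n) $$ (i, j))"

definition aperiodic_chain :: "nat \<Rightarrow> real mat \<Rightarrow> bool" where
  "aperiodic_chain m P \<longleftrightarrow> (\<forall>i<m. Gcd {n. 1 \<le> n \<and> 0 < (P ^\<^sub>m n) $$ (i, i)} = 1)"

definition stationary_distribution :: "nat \<Rightarrow> real mat \<Rightarrow> real vec \<Rightarrow> bool" where
  "stationary_distribution m P \<pi> \<longleftrightarrow>
     \<pi> \<in> carrier_vec m \<and>
     (\<forall>i<m. 0 \<le> \<pi> $ i) \<and>
     (\<Sum>i<m. \<pi> $ i) = 1 \<and>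
     (\<forall>j<m. (\<Sum>i<m. \<pi> $ i * P $$ (i, j)) = \<pi> $ j)"

text \<open>
  A path \<open>\<alpha> (w 0), \<dots>, \<alpha> (w n)\<close> is given by its sequence \<open>w\<close> of letter indices. The last condition is
  the Markov property together with homogeneity; it is required for pasts of positive probability
  only.
\<close>

definition markov_chain ::
  "'a measure \<Rightarrow> nat \<Rightarrow> (nat \<Rightarrow> 'b) \<Rightarrow> real mat \<Rightarrow> (nat \<Rightarrow> 'a \<Rightarrow> 'b) \<Rightarrow> bool" where
  "markov_chain M m \<alpha> P X \<longleftrightarrow>
     stochastic_mat m P \<and>
     (\<forall>n. X n \<in> measurable M (count_space (\<alpha> ` {..<m}))) \<and>
     (\<forall>n w j. (\<forall>i\<le>n. w i < m) \<longrightarrow> j < m \<longrightarrow>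
        \<P>(\<omega> in M. \<forall>i\<le>n. X i \<omega> = \<alpha> (w i)) > 0 \<longrightarrow>
        \<P>(\<omega> in M. X (Suc n) \<omega> = \<alpha> j \<bar> \<forall>i\<le>n. X i \<omega> = \<alpha> (w i)) = P $$ (w n, j))"

definition occurrences :: "(nat \<Rightarrow> 'b) \<Rightarrow> (nat \<Rightarrow> 'a \<Rightarrow> 'b) \<Rightarrow> nat \<Rightarrow> nat \<Rightarrow> 'a \<Rightarrow> nat" where
  "occurrences \<alpha> X r k \<omega> = card {i \<in> {1..k}. X i \<omega> = \<alpha> r}"

text \<open>For \<open>k = 0\<close> this is \<open>0\<close>.\<close>

definition centered_count ::
  "(nat \<Rightarrow> 'b) \<Rightarrow> real vec \<Rightarrow> (nat \<Rightarrow> 'a \<Rightarrow> 'b) \<Rightarrow> nat \<Rightarrow> nat \<Rightarrow> 'a \<Rightarrow> real" where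
  "centered_count \<alpha> \<pi> X r k \<omega> = real (occurrences \<alpha> X r k \<omega>) - \<pi> $ r * real k"

definition covariance :: "'a measure \<Rightarrow> ('a \<Rightarrow> real) \<Rightarrow> ('a \<Rightarrow> real) \<Rightarrow> real" where
  "covariance M Y Z =
     integral\<^sup>L M (\<lambda>\<omega>. (Y \<omega> - integral\<^sup>L M Y) * (Z \<omega> - integral\<^sup>L M Z))"

text \<open>
  \<open>P = S\<^sup>-\<^sup>1 diag(1, L) S\<close> over the complex numbers, where \<open>L\<close> consists of lower Jordan blocks
  (subdiagonal entries \<open>1\<close>); \<^const>\<open>jordan_matrix\<close> has upper blocks, hence the transposition. It
  follows that the rows of \<open>S\<close> are generalized left eigenvectors of \<open>P\<close>.
\<close>

definition left_jordan_decomposition ::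
  "real mat \<Rightarrow> real vec \<Rightarrow> complex mat \<Rightarrow> complex mat \<Rightarrow> complex mat \<Rightarrow> bool" where
  "left_jordan_decomposition P \<pi> Sinv L S \<longleftrightarrow>
     similar_mat_wit (map_mat complex_of_real P) (diag_block_mat [1\<^sub>m 1, L]) Sinv S \<and>
     row S 0 = map_vec complex_of_real \<pi> \<and>
     (\<exists>bs. 0 \<notin> fst ` set bs \<and> L = transpose_mat (jordan_matrix bs))"

definition D_mat :: "complex mat \<Rightarrow> complex mat" where
  "D_mat L = diag_block_mat
     [mat 1 1 (\<lambda>_. - 1 / 2), L * the (mat_inverse (1\<^sub>m (dim_row L) - L))]"

text \<open>The number \<open>e\<^sub>r A e\<^sub>s\<^sup>T\<close>.\<close>

definition std_form :: "nat \<Rightarrow> nat \<Rightarrow> complex mat \<Rightarrow> nat \<Rightarrow> complex" where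
  "std_form m r A s = scalar_prod (unit_vec m r) (A *\<^sub>v unit_vec m s)"

definition Pi_mat :: "nat \<Rightarrow> real vec \<Rightarrow> complex mat" where
  "Pi_mat m \<pi> = mat m m (\<lambda>(i, j). if i = j then complex_of_real (\<pi> $ i) else 0)"

definition Sigma_mat :: "nat \<Rightarrow> real vec \<Rightarrow> complex mat \<Rightarrow> complex mat" where
  "Sigma_mat m \<pi> Q = Pi_mat m \<pi> + Pi_mat m \<pi> * Q + transpose_mat Q * Pi_mat m \<pi>"

end

theory Submission
  imports Defs
begin

text \<open>
  Let \<open>J\<close> be the matrix all of whose rows are \<open>\<pi>\<close>. By the maximum principle, irreducibility makes
  every fixed vector of \<open>P\<close> constant. So the first column of \<open>S\<^sup>-\<^sup>1\<close> consists of ones,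
  \<open>J = S\<^sup>-\<^sup>1 diag(1, 0) S\<close>, and \<open>1 - L\<close> is invertible. Then \<open>R = S\<^sup>-\<^sup>1 diag(0, L (1 - L)\<^sup>-\<^sup>1) S\<close> is
  \<open>S\<^sup>-\<^sup>1 D S + J / 2\<close>, and with \<open>W = S\<^sup>-\<^sup>1 diag(0, L (1 - L)\<^sup>-\<^sup>2) S\<close> one has \<open>R - P R = P - J\<close> and
  \<open>W - P W = R\<close>.

  Passing from \<open>k\<close> to \<open>k + 1\<close>, the covariance grows by a constant plus sums of entries of
  \<open>P\<^sup>d - J\<close> over \<open>1 \<le> d \<le> k\<close>, which telescope to \<open>R - P\<^sup>k R\<close>. Summing once more, the terms
  \<open>P\<^sup>k R\<close> telescope to \<open>W - P\<^sup>k W\<close>, which is bounded because the powers of \<open>P\<close> are stochastic. So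
  the covariance is linear in \<open>k\<close> up to a bounded error.
\<close>

section \<open>Stochastic matrices and the maximum principle\<close>

lemma mult_mat_entry:
  assumes "A \<in> carrier_mat a b" "B \<in> carrier_mat b c" "i < a" "j < c"
  shows "(A * B) $$ (i, j) = (\<Sum>l<b. A $$ (i, l) * B $$ (l, j))"
  using assms by (auto simp: scalar_prod_def lessThan_atLeast0)

lemma stochastic_mat_carrier: "stochastic_mat m P \<Longrightarrow> P \<in> carrier_mat m m"
  by (simp add: stochastic_mat_def)

lemma stochastic_mat_mult:
  assumes "stochastic_mat m A" "stochastic_mat m B"
  shows "stochastic_mat m (A * B)"
proof -
  have A: "A \<in> carrier_mat m m" and B: "B \<in> carrier_mat m m"
    using assms by (auto simp: stochastic_mat_def)
  have e: "(A * B) $$ (i, j) = (\<Sum>l<m. A $$ (i, l) * B $$ (l, j))" if "i < m" "j < m" for i j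
    using mult_mat_entry[OF A B that] .
  have "(\<Sum>j<m. (A * B) $$ (i, j)) = 1" if i: "i < m" for i
  proof -
    have "(\<Sum>j<m. (A * B) $$ (i, j)) = (\<Sum>j<m. \<Sum>l<m. A $$ (i, l) * B $$ (l, j))"
      using e i by (intro sum.cong) auto
    also have "\<dots> = (\<Sum>l<m. A $$ (i, l) * (\<Sum>j<m. B $$ (l, j)))"
      by (subst sum.swap) (simp add: sum_distrib_left)
    also have "\<dots> = 1"
      using assms i by (simp add: stochastic_mat_def)
    finally show ?thesis .
  qed
  moreover have "0 \<le> (A * B) $$ (i, j)" if "i < m" "j < m" for i j
    unfolding e[OF that] using assms that by (auto simp: stochastic_mat_def intro!: sum_nonneg)
  ultimately show ?thesis
    using A B by (auto simp: stochastic_mat_def)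
qed

lemma stochastic_mat_pow:
  assumes "stochastic_mat m P"
  shows "stochastic_mat m (P ^\<^sub>m n)"
proof (induction n)
  case 0
  show ?case using assms by (auto simp: stochastic_mat_def)
next
  case (Suc n)
  then show ?case using assms by (simp add: stochastic_mat_mult)
qed

lemma pow_mat_harmonic:
  fixes h :: "nat \<Rightarrow> real"
  assumes P: "stochastic_mat m P"
    and h: "\<And>i. i < m \<Longrightarrow> (\<Sum>j<m. P $$ (i, j) * h j) = h i"
    and "i < m"
  shows "(\<Sum>j<m. (P ^\<^sub>m n) $$ (i, j) * h j) = h i"
  using \<open>i < m\<close>
proof (induction n)
  case 0
  then show ?case
    using stochastic_mat_carrier[OF P] by (simp add: if_distrib[of "\<lambda>x. x * _"] cong: if_cong)
next
  case (Suc n)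
  note carr = stochastic_mat_carrier[OF stochastic_mat_pow[OF P]] stochastic_mat_carrier[OF P]
  have "(\<Sum>j<m. (P ^\<^sub>m Suc n) $$ (i, j) * h j)
      = (\<Sum>j<m. \<Sum>l<m. (P ^\<^sub>m n) $$ (i, l) * P $$ (l, j) * h j)"
    using mult_mat_entry[OF carr] Suc.prems by (simp add: sum_distrib_right)
  also have "\<dots> = (\<Sum>l<m. (P ^\<^sub>m n) $$ (i, l) * (\<Sum>j<m. P $$ (l, j) * h j))"
    by (subst sum.swap) (simp add: sum_distrib_left mult.assoc)
  also have "\<dots> = h i"
    using Suc by (simp add: h)
  finally show ?case .
qed

text \<open>At a state \<open>x\<close> where \<open>h\<close> is maximal, \<open>h x\<close> is the
  average of \<open>h\<close> under row \<open>x\<close> of \<open>P ^\<^sub>m n\<close>. The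
  deficits \<open>h x - h l\<close> are nonnegative and average to 0, so they vanish wherever that
  row is positive. Irreducibility supplies, for each \<open>y\<close>, an exponent \<open>n\<close>
  that makes the entry \<open>(x, y)\<close> positive.\<close>

lemma irreducible_harmonic_constant:
  fixes h :: "nat \<Rightarrow> real"
  assumes P: "stochastic_mat m P" and irr: "irreducible_chain m P"
    and h: "\<And>i. i < m \<Longrightarrow> (\<Sum>j<m. P $$ (i, j) * h j) = h i"
    and ij: "i < m" "j < m"
  shows "h i = h j"
proof -
  have fin: "finite (h ` {..<m})" "h ` {..<m} \<noteq> {}"
    using ij by auto
  obtain x where x0: "x < m" "Max (h ` {..<m}) = h x"
    using Max_in[OF fin] by auto
  have x: "x < m" "\<And>y. y < m \<Longrightarrow> h y \<le> h x"
    using x0 Max_ge[OF fin(1)] by auto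
  have "h y = h x" if y: "y < m" for y
  proof -
    obtain n where n: "0 < (P ^\<^sub>m n) $$ (x, y)"
      using irr x(1) y unfolding irreducible_chain_def by metis
    have st: "stochastic_mat m (P ^\<^sub>m n)"
      by (rule stochastic_mat_pow[OF P])
    have "(\<Sum>l<m. (P ^\<^sub>m n) $$ (x, l) * (h x - h l))
        = (\<Sum>l<m. (P ^\<^sub>m n) $$ (x, l)) * h x - (\<Sum>l<m. (P ^\<^sub>m n) $$ (x, l) * h l)"
      by (simp add: right_diff_distrib sum_subtractf sum_distrib_right)
    also have "\<dots> = 0"
      using pow_mat_harmonic[OF P h x(1), of n] st x(1) by (simp add: stochastic_mat_def)
    finally have "(P ^\<^sub>m n) $$ (x, y) * (h x - h y) = 0"
      using st x y
      by (subst (asm) sum_nonneg_eq_0_iff) (auto simp: stochastic_mat_def)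
    then show ?thesis using n by simp
  qed
  then show ?thesis using ij by metis
qed

text \<open>Since \<open>P\<close> is real, the real and imaginary parts of a fixed vector are
  themselves harmonic. The complex version is required because the columns of \<open>Sinv\<close>
  are complex.\<close>

lemma irreducible_fixed_vec_constant:
  fixes v :: "complex vec"
  assumes P: "stochastic_mat m P" and irr: "irreducible_chain m P"
    and v: "v \<in> carrier_vec m" and fx: "map_mat complex_of_real P *\<^sub>v v = v"
    and ij: "i < m" "j < m"
  shows "v $ i = v $ j"
proof -
  have e: "(\<Sum>j<m. complex_of_real (P $$ (i, j)) * v $ j) = v $ i" if "i < m" for i
  proof -
    have "(map_mat complex_of_real P *\<^sub>v v) $ i = (\<Sum>j<m. complex_of_real (P $$ (i, j)) * v $ j)"
      using that stochastic_mat_carrier[OF P] v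
      by (auto simp: scalar_prod_def lessThan_atLeast0)
    then show ?thesis using fx by simp
  qed
  have "(\<Sum>j<m. P $$ (i, j) * Re (v $ j)) = Re (v $ i)"
       "(\<Sum>j<m. P $$ (i, j) * Im (v $ j)) = Im (v $ i)" if "i < m" for i
    using arg_cong[OF e[OF that], of Re] arg_cong[OF e[OF that], of Im] by auto
  then show ?thesis
    using irreducible_harmonic_constant[OF P irr, of "\<lambda>j. Re (v $ j)" i j]
      irreducible_harmonic_constant[OF P irr, of "\<lambda>j. Im (v $ j)" i j] ij
    by (auto intro: complex_eqI)
qed

section \<open>Block-diagonal matrices with a scalar first block, and conjugation\<close>

definition block_diag :: "complex \<Rightarrow> complex mat \<Rightarrow> complex mat" where
  "block_diag a K = diag_block_mat [mat 1 1 (\<lambda>_. a), K]"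

text \<open>Both diag(1, \<open>L\<close>) and \<open>D_mat L\<close> have the shape of
  \<open>block_diag\<close>. As a four-block matrix it falls under
  \<open>mult_four_block_mat\<close>, which yields the blockwise product below.\<close>

lemma block_diag_four_block:
  assumes "K \<in> carrier_mat n n"
  shows "block_diag a K = four_block_mat (mat 1 1 (\<lambda>_. a)) (0\<^sub>m 1 n) (0\<^sub>m n 1) K"
  using assms diag_block_mat.simps(2)[of "mat 1 1 (\<lambda>_. a)" "[K]"]
  by (simp add: block_diag_def Let_def del: diag_block_mat.simps)

lemma block_diag_carrier [simp]:
  "K \<in> carrier_mat n n \<Longrightarrow> block_diag a K \<in> carrier_mat (Suc n) (Suc n)"
  by (auto simp: block_diag_four_block)

lemma block_diag_entry:
  assumes "K \<in> carrier_mat n n" "i < Suc n" "j < Suc n"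
  shows "block_diag a K $$ (i, j) =
    (if i = 0 then if j = 0 then a else 0 else if j = 0 then 0 else K $$ (i - 1, j - 1))"
  using assms by (auto simp: block_diag_four_block four_block_mat_def Let_def)

lemma block_diag_add:
  assumes "K \<in> carrier_mat n n" "K' \<in> carrier_mat n n"
  shows "block_diag a K + block_diag b K' = block_diag (a + b) (K + K')"
proof (rule eq_matI)
  have c: "K + K' \<in> carrier_mat n n" using assms by simp
  note d = block_diag_carrier[OF assms(1), of a] block_diag_carrier[OF assms(2), of b]
    block_diag_carrier[OF c, of "a + b"]
  show "dim_row (block_diag a K + block_diag b K') = dim_row (block_diag (a + b) (K + K'))"
    "dim_col (block_diag a K + block_diag b K') = dim_col (block_diag (a + b) (K + K'))"
    using d by (metis carrier_matD add_carrier_mat)+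
  fix i j
  assume "i < dim_row (block_diag (a + b) (K + K'))" "j < dim_col (block_diag (a + b) (K + K'))"
  then have ij: "i < Suc n" "j < Suc n" using d(3) by (metis carrier_matD)+
  then show "(block_diag a K + block_diag b K') $$ (i, j) = block_diag (a + b) (K + K') $$ (i, j)"
    using assms carrier_matD[OF d(2)] block_diag_entry[OF assms(1) ij]
      block_diag_entry[OF assms(2) ij] block_diag_entry[OF c ij]
    by auto
qed

lemma block_diag_mult:
  assumes K: "K \<in> carrier_mat n n" "K' \<in> carrier_mat n n"
  shows "block_diag a K * block_diag b K' = block_diag (a * b) (K * K')"
proof -
  have c: "K * K' \<in> carrier_mat n n" using K by simp
  have "mat (Suc 0) (Suc 0) (\<lambda>_. a) * mat (Suc 0) (Suc 0) (\<lambda>_. b)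
      = mat (Suc 0) (Suc 0) (\<lambda>_. a * b)"
    by (rule eq_matI) (auto simp: scalar_prod_def)
  then show ?thesis
    unfolding block_diag_four_block[OF K(1)] block_diag_four_block[OF K(2)]
      block_diag_four_block[OF c]
    by (subst mult_four_block_mat[of _ 1 1 _ n _ n _ _ 1 _ n]) (use K in auto)
qed

lemma conj_add:
  fixes A B U V :: "complex mat"
  assumes "A \<in> carrier_mat m m" "B \<in> carrier_mat m m" "U \<in> carrier_mat m m" "V \<in> carrier_mat m m"
  shows "U * (A + B) * V = U * A * V + U * B * V"
  using assms by (simp add: mult_add_distrib_mat[of _ m m] add_mult_distrib_mat[of _ m m])

lemma conj_mult:
  fixes A B U V :: "complex mat"
  assumes "A \<in> carrier_mat m m" "B \<in> carrier_mat m m" "U \<in> carrier_mat m m" "V \<in> carrier_mat m m"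
    and "V * U = 1\<^sub>m m"
  shows "(U * A * V) * (U * B * V) = U * (A * B) * V"
proof -
  have "(U * A * V) * (U * B * V) = U * A * (V * U) * B * V"
    using assms(1-4) by (simp add: assoc_mult_mat[of _ m m _ m _ m])
  also have "\<dots> = U * (A * B) * V"
    unfolding assms(5) using assms(1-4) by (simp add: assoc_mult_mat[of _ m m _ m _ m])
  finally show ?thesis .
qed

section \<open>The Jordan decomposition and the inverse of 1 - \<open>L\<close>\<close>

locale left_jordan_chain =
  fixes n :: nat and P :: "real mat" and \<pi> :: "real vec" and Sinv L S :: "complex mat"
  assumes stoch: "stochastic_mat (Suc n) P"
    and irr: "irreducible_chain (Suc n) P"
    and sum_pi: "(\<Sum>i<Suc n. \<pi> $ i) = 1"
    and pi_carrier: "\<pi> \<in> carrier_vec (Suc n)"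
    and jordan: "left_jordan_decomposition P \<pi> Sinv L S"
begin

abbreviation "Pc \<equiv> map_mat complex_of_real P"

lemma L_carrier: "L \<in> carrier_mat n n"
  and Sinv_carrier: "Sinv \<in> carrier_mat (Suc n) (Suc n)"
  and S_carrier: "S \<in> carrier_mat (Suc n) (Suc n)"
  and Pc_carrier: "Pc \<in> carrier_mat (Suc n) (Suc n)"
  and Sinv_S: "Sinv * S = 1\<^sub>m (Suc n)"
  and S_Sinv: "S * Sinv = 1\<^sub>m (Suc n)"
  and Pc_eq: "Pc = Sinv * block_diag 1 L * S"
proof -
  have "1\<^sub>m 1 = mat 1 1 (\<lambda>_. 1 :: complex)"
    by (rule eq_matI) auto
  then have w: "similar_mat_wit Pc (block_diag 1 L) Sinv S"
    using jordan unfolding left_jordan_decomposition_def block_diag_def by metis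
  show pc: "Pc \<in> carrier_mat (Suc n) (Suc n)"
    using stochastic_mat_carrier[OF stoch] by simp
  note w = similar_mat_witD2[OF pc w]
  show "Sinv \<in> carrier_mat (Suc n) (Suc n)" "S \<in> carrier_mat (Suc n) (Suc n)"
    "Sinv * S = 1\<^sub>m (Suc n)" "S * Sinv = 1\<^sub>m (Suc n)" "Pc = Sinv * block_diag 1 L * S"
    using w by auto
  \<comment> \<open>The size of \<open>L\<close> is read off from that of the whole block matrix:
    what remains of \<open>Suc n\<close> after the 1 by 1 block.\<close>
  have "diag_block_mat [mat 1 1 (\<lambda>_. 1), L] \<in> carrier_mat (Suc n) (Suc n)"
    using w(5) by (simp only: block_diag_def)
  then have "dim_row (diag_block_mat [mat 1 1 (\<lambda>_. 1), L]) = Suc n"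
    "dim_col (diag_block_mat [mat 1 1 (\<lambda>_. 1), L]) = Suc n"
    by (simp_all only: carrier_matD)
  then show "L \<in> carrier_mat n n"
    by (auto simp: Let_def)
qed

lemma S_row_0: "s < Suc n \<Longrightarrow> S $$ (0, s) = complex_of_real (\<pi> $ s)"
proof -
  assume s: "s < Suc n"
  have "row S 0 $ s = map_vec complex_of_real \<pi> $ s"
    using jordan by (simp add: left_jordan_decomposition_def)
  then show ?thesis using s S_carrier pi_carrier by auto
qed

lemma sum_pi_complex: "(\<Sum>i<Suc n. complex_of_real (\<pi> $ i)) = 1"
  using arg_cong[OF sum_pi, of complex_of_real] by simp

text \<open>Column 0 of \<open>Pc * Sinv = Sinv * block_diag 1 L\<close> says that column 0 of
  \<open>Sinv\<close> is fixed by \<open>Pc\<close>, hence constant. Row 0 of \<open>S\<close> is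
  \<pi>, so entry (0, 0) of \<open>S * Sinv = 1\<^sub>m (Suc n)\<close> makes the \<pi>-average of
  that constant equal to 1.\<close>

lemma Sinv_col_0:
  assumes "r < Suc n"
  shows "Sinv $$ (r, 0) = 1"
proof -
  have "Pc * Sinv = Sinv * block_diag 1 L * (S * Sinv)"
    unfolding Pc_eq
    by (rule assoc_mult_mat[OF mult_carrier_mat[OF Sinv_carrier block_diag_carrier[OF L_carrier]]
          S_carrier Sinv_carrier])
  then have eq: "Pc * Sinv = Sinv * block_diag 1 L"
    using right_mult_one_mat[OF mult_carrier_mat[OF Sinv_carrier block_diag_carrier[OF L_carrier]]]
    by (simp add: S_Sinv)
  have "Pc *\<^sub>v col Sinv 0 = col (Pc * Sinv) 0"
    using Pc_carrier Sinv_carrier by (intro eq_vecI) auto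
  also have "\<dots> = col Sinv 0"
  proof (rule eq_vecI)
    fix i assume "i < dim_vec (col Sinv 0)"
    then have i: "i < Suc n" using Sinv_carrier by simp
    have "(Pc * Sinv) $$ (i, 0) = (\<Sum>l<Suc n. Sinv $$ (i, l) * block_diag 1 L $$ (l, 0))"
      unfolding eq
      by (rule mult_mat_entry[OF Sinv_carrier block_diag_carrier[OF L_carrier] i]) simp
    also have "\<dots> = (\<Sum>l<Suc n. if l = 0 then Sinv $$ (i, l) else 0)"
      by (rule sum.cong) (auto simp: block_diag_entry[OF L_carrier])
    also have "\<dots> = Sinv $$ (i, 0)" by simp
    finally show "col (Pc * Sinv) 0 $ i = col Sinv 0 $ i"
      using i Pc_carrier Sinv_carrier by simp
  qed (use Pc_carrier Sinv_carrier in simp)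
  finally have fx: "Pc *\<^sub>v col Sinv 0 = col Sinv 0" .
  have cc: "col Sinv 0 \<in> carrier_vec (Suc n)"
    using Sinv_carrier by (intro carrier_vecI) simp
  have c: "Sinv $$ (i, 0) = Sinv $$ (r, 0)" if "i < Suc n" for i
    using irreducible_fixed_vec_constant[OF stoch irr cc fx that assms] that assms Sinv_carrier
    by simp
  have "1 = (S * Sinv) $$ (0, 0)" by (simp add: S_Sinv)
  also have "\<dots> = (\<Sum>l<Suc n. S $$ (0, l) * Sinv $$ (l, 0))"
    by (rule mult_mat_entry) (use S_carrier Sinv_carrier in auto)
  also have "\<dots> = (\<Sum>l<Suc n. complex_of_real (\<pi> $ l)) * Sinv $$ (r, 0)"
    unfolding sum_distrib_right
  proof (rule sum.cong)
    fix l assume "l \<in> {..<Suc n}"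
    then have l: "l < Suc n" by simp
    show "S $$ (0, l) * Sinv $$ (l, 0) = complex_of_real (\<pi> $ l) * Sinv $$ (r, 0)"
      by (simp only: S_row_0[OF l] c[OF l])
  qed simp
  finally show ?thesis unfolding sum_pi_complex by (simp only: mult_1_left)
qed

text \<open>A fixed vector of \<open>L\<close> would extend by \<open>0\<close> to a fixed vector of \<open>diag(1, L)\<close>; its image under
  \<open>S\<^sup>-\<^sup>1\<close> is fixed by \<open>P\<close>, hence constant, and it is orthogonal to \<open>\<pi>\<close>, hence zero.\<close>

lemma L_no_fixed_vec:
  assumes v: "v \<in> carrier_vec n" and fx: "L *\<^sub>v v = v"
  shows "v = 0\<^sub>v n"
proof -
  define u where "u = vec (Suc n) (\<lambda>i. if i = 0 then 0 else v $ (i - 1))"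
  have u: "u \<in> carrier_vec (Suc n)" by (simp add: u_def)
  have Bu: "block_diag 1 L *\<^sub>v u = u"
  proof (rule eq_vecI)
    fix i assume "i < dim_vec u"
    then have i: "i < Suc n" by (simp add: u_def)
    have "(block_diag 1 L *\<^sub>v u) $ i = (\<Sum>l<Suc n. block_diag 1 L $$ (i, l) * u $ l)"
      using i u block_diag_carrier[OF L_carrier, of 1]
      by (auto simp: scalar_prod_def lessThan_atLeast0 simp del: sum.op_ivl_Suc)
    also have "\<dots> = (\<Sum>l<n. if i = 0 then 0 else L $$ (i - 1, l) * v $ l)"
      using i by (subst sum.lessThan_Suc_shift)
        (auto simp: block_diag_entry[OF L_carrier] u_def intro!: sum.cong)
    also have "\<dots> = (if i = 0 then 0 else (L *\<^sub>v v) $ (i - 1))"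
      using i v L_carrier by (auto simp: scalar_prod_def lessThan_atLeast0)
    finally show "(block_diag 1 L *\<^sub>v u) $ i = u $ i"
      using i fx by (simp add: u_def)
  qed (use block_diag_carrier[OF L_carrier, of 1] in \<open>simp add: u_def\<close>)
  define w where "w = Sinv *\<^sub>v u"
  have w: "w \<in> carrier_vec (Suc n)" using Sinv_carrier u by (simp add: w_def)
  have Sw: "S *\<^sub>v w = u"
    using S_carrier Sinv_carrier u
    by (simp add: w_def assoc_mult_mat_vec[symmetric, of _ "Suc n" "Suc n" _ "Suc n"] S_Sinv)
  have "Pc *\<^sub>v w = Sinv *\<^sub>v (block_diag 1 L *\<^sub>v (S *\<^sub>v w))"
    unfolding Pc_eq using S_carrier Sinv_carrier w block_diag_carrier[OF L_carrier, of 1]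
    by (simp add: assoc_mult_mat_vec[of _ "Suc n" "Suc n" _ "Suc n"])
  then have "Pc *\<^sub>v w = w"
    unfolding Sw Bu by (simp only: w_def)
  then have c: "w $ i = w $ 0" if "i < Suc n" for i
    using irreducible_fixed_vec_constant[OF stoch irr w _ that] by simp
  have "0 = (S *\<^sub>v w) $ 0" by (simp add: Sw) (simp add: u_def)
  also have "\<dots> = (\<Sum>l<Suc n. S $$ (0, l) * w $ l)"
    using S_carrier w
    by (auto simp: scalar_prod_def lessThan_atLeast0 simp del: sum.op_ivl_Suc)
  also have "\<dots> = (\<Sum>l<Suc n. complex_of_real (\<pi> $ l)) * w $ 0"
    unfolding sum_distrib_right
  proof (rule sum.cong)
    fix l assume "l \<in> {..<Suc n}"
    then have l: "l < Suc n" by simp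
    show "S $$ (0, l) * w $ l = complex_of_real (\<pi> $ l) * w $ 0"
      by (simp only: S_row_0[OF l] c[OF l])
  qed simp
  finally have w0: "w $ 0 = 0" unfolding sum_pi_complex by (simp only: mult_1_left)
  have "w = 0\<^sub>v (Suc n)"
  proof (rule eq_vecI)
    fix i assume "i < dim_vec (0\<^sub>v (Suc n) :: complex vec)"
    then have i: "i < Suc n" by simp
    show "w $ i = 0\<^sub>v (Suc n) $ i" using c[OF i] w0 i by simp
  qed (use w in simp)
  then have u0: "u = 0\<^sub>v (Suc n)" using Sw mult_mat_vec_carrier[OF S_carrier] S_carrier by auto
  show ?thesis
  proof (rule eq_vecI)
    fix i assume "i < dim_vec (0\<^sub>v n :: complex vec)"
    then have i: "i < n" by simp
    have "u $ Suc i = v $ i" using i by (simp add: u_def)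
    then show "v $ i = 0\<^sub>v n $ i" using i by (simp add: u0)
  qed (use v in simp)
qed

text \<open>The inverse of 1 - \<open>L\<close>, in the form in which it occurs in
  \<open>D_mat\<close>. That the option is a \<open>Some\<close> is part of the next proof.\<close>

definition N where "N = the (mat_inverse (1\<^sub>m n - L))"

text \<open>If det(1 - \<open>L\<close>) were 0, some nonzero \<open>v\<close> would satisfy
  \<open>L *\<^sub>v v = v\<close>, against \<open>L_no_fixed_vec\<close>.\<close>

lemma N_carrier: "N \<in> carrier_mat n n"
  and N_inverse: "(1\<^sub>m n - L) * N = 1\<^sub>m n"
proof -
  have c: "1\<^sub>m n - L \<in> carrier_mat n n" using L_carrier by (simp add: minus_carrier_mat)
  have "det (1\<^sub>m n - L) \<noteq> 0"
  proof
    assume "det (1\<^sub>m n - L) = 0"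
    then obtain v where v: "v \<in> carrier_vec n" "v \<noteq> 0\<^sub>v n" "(1\<^sub>m n - L) *\<^sub>v v = 0\<^sub>v n"
      using det_0_iff_vec_prod_zero_field[OF c] by auto
    have "v - L *\<^sub>v v = 0\<^sub>v n"
      using v L_carrier by (simp add: minus_mult_distrib_mat_vec[of _ n n])
    then have "L *\<^sub>v v = v"
      using v(1) L_carrier by (auto simp: vec_eq_iff)
    with L_no_fixed_vec v show False by blast
  qed
  from det_non_zero_imp_unit[OF c this, of "()"] obtain B
    where "mat_inverse (1\<^sub>m n - L) = Some B"
    using mat_inverse(1)[OF c, of "()"] by (cases "mat_inverse (1\<^sub>m n - L)") auto
  then show "N \<in> carrier_mat n n" "(1\<^sub>m n - L) * N = 1\<^sub>m n"
    using mat_inverse(2)[OF c] by (auto simp: N_def)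
qed

text \<open>This is \<open>N = L * N + 1\<^sub>m n\<close> multiplied by \<open>L\<close> from the
  left. It is the block identity behind both \<open>R_eq\<close> and \<open>W_eq\<close>.\<close>

lemma L_N: "L * N = L * (L * N) + L"
proof -
  have "N - L * N = 1\<^sub>m n"
    using N_inverse L_carrier N_carrier by (simp add: minus_mult_distrib_mat[of _ n n])
  then have "N = L * N + 1\<^sub>m n"
    using L_carrier N_carrier by (auto simp: mat_eq_iff algebra_simps)
  then have "L * N = L * (L * N + 1\<^sub>m n)" by (rule arg_cong)
  also have "\<dots> = L * (L * N) + L"
    by (simp only: mult_add_distrib_mat[OF L_carrier mult_carrier_mat[OF L_carrier N_carrier]
          one_carrier_mat] right_mult_one_mat[OF L_carrier])
  finally show ?thesis .
qed

section \<open>The matrices \<open>J\<close>, \<open>R\<close>, \<open>W\<close> and their Poisson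
  equations\<close>

definition J :: "complex mat" where
  "J = mat (Suc n) (Suc n) (\<lambda>(i, j). complex_of_real (\<pi> $ j))"

text \<open>Only column 0 of \<open>Sinv\<close> and row 0 of \<open>S\<close> meet the nonzero
  entry. The former consists of ones and the latter is \<pi>, so their outer product is
  \<open>J\<close>.\<close>

lemma conj_rank_one:
  "Sinv * block_diag a (0\<^sub>m n n) * S = a \<cdot>\<^sub>m J"
proof (rule eq_matI)
  let ?Z = "0\<^sub>m n n :: complex mat"
  have B: "block_diag a ?Z \<in> carrier_mat (Suc n) (Suc n)" by simp
  show "dim_row (Sinv * block_diag a ?Z * S) = dim_row (a \<cdot>\<^sub>m J)"
    "dim_col (Sinv * block_diag a ?Z * S) = dim_col (a \<cdot>\<^sub>m J)"
    using Sinv_carrier S_carrier by (auto simp: J_def)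
  fix r s assume "r < dim_row (a \<cdot>\<^sub>m J)" "s < dim_col (a \<cdot>\<^sub>m J)"
  then have rs: "r < Suc n" "s < Suc n" by (auto simp: J_def)
  have SB: "(Sinv * block_diag a ?Z) $$ (r, l) = (if l = 0 then a else 0)" if l: "l < Suc n" for l
  proof -
    have "(Sinv * block_diag a ?Z) $$ (r, l)
        = (\<Sum>k<Suc n. Sinv $$ (r, k) * block_diag a ?Z $$ (k, l))"
      by (rule mult_mat_entry[OF Sinv_carrier B rs(1) l])
    also have "\<dots> = (\<Sum>k<Suc n. if k = 0 then if l = 0 then a else 0 else 0)"
      by (rule sum.cong)
        (use l rs in \<open>auto simp: block_diag_entry[of ?Z n] Sinv_col_0\<close>)
    also have "\<dots> = (if l = 0 then a else 0)" by simp
    finally show ?thesis .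
  qed
  have "(Sinv * block_diag a ?Z * S) $$ (r, s)
      = (\<Sum>l<Suc n. (Sinv * block_diag a ?Z) $$ (r, l) * S $$ (l, s))"
    by (rule mult_mat_entry[OF mult_carrier_mat[OF Sinv_carrier B] S_carrier rs])
  also have "\<dots> = (\<Sum>l<Suc n. if l = 0 then a * S $$ (0, s) else 0)"
    by (rule sum.cong) (auto simp: SB)
  finally show "(Sinv * block_diag a ?Z * S) $$ (r, s) = (a \<cdot>\<^sub>m J) $$ (r, s)"
    using rs by (simp add: S_row_0 J_def)
qed

text \<open>Formally, \<open>R\<close> is the sum of \<open>P^d - J\<close> over d \<ge> 1, and
  \<open>W\<close> is the sum of \<open>P^j R\<close> over j \<ge> 0. The closed forms with
  \<open>N\<close> give these matrices a meaning without any convergent series.\<close>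

definition R where "R = Sinv * block_diag 0 (L * N) * S"
definition W where "W = Sinv * block_diag 0 (L * N * N) * S"

lemma J_carrier: "J \<in> carrier_mat (Suc n) (Suc n)"
  and R_carrier: "R \<in> carrier_mat (Suc n) (Suc n)"
  and W_carrier: "W \<in> carrier_mat (Suc n) (Suc n)"
  unfolding J_def R_def W_def
  by (simp, intro mult_carrier_mat[OF mult_carrier_mat[OF Sinv_carrier block_diag_carrier] S_carrier]
        mult_carrier_mat[OF _ N_carrier] L_carrier
      , intro mult_carrier_mat[OF mult_carrier_mat[OF Sinv_carrier block_diag_carrier] S_carrier]
        mult_carrier_mat[OF _ N_carrier] L_carrier)

text \<open>After removing the conjugation, this is \<open>L_N\<close> in the lower block and 0 + 1
  = 1 * 0 + 1 in the scalar block.\<close>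

lemma R_eq: "R + J = Pc * R + Pc"
proof -
  note c = Sinv_carrier S_carrier L_carrier N_carrier
  have c2: "L * N \<in> carrier_mat n n" "L * (L * N) \<in> carrier_mat n n" "0\<^sub>m n n \<in> carrier_mat n n"
    using c by auto
  have one_J: "1 \<cdot>\<^sub>m J = J"
    by (rule eq_matI) auto
  have "R + J = Sinv * (block_diag 0 (L * N) + block_diag 1 (0\<^sub>m n n)) * S"
    using conj_rank_one[of 1] one_J c c2 J_carrier
    by (simp add: R_def conj_add[of _ "Suc n"])
  also have "block_diag 0 (L * N) + block_diag 1 (0\<^sub>m n n) = block_diag 1 (L * N)"
    using c2 by (simp add: block_diag_add)
  also have "\<dots> = block_diag 0 (L * (L * N)) + block_diag 1 L"
    using block_diag_add[OF c2(2) c(3), of 0 1] by (simp add: L_N[symmetric])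
  also have "block_diag 0 (L * (L * N)) = block_diag 1 L * block_diag 0 (L * N)"
    using c c2 by (simp add: block_diag_mult)
  also have "Sinv * (block_diag 1 L * block_diag 0 (L * N) + block_diag 1 L) * S = Pc * R + Pc"
    unfolding R_def Pc_eq conj_mult[OF block_diag_carrier[OF c(3)]
        block_diag_carrier[OF c2(1)] c(1,2) S_Sinv]
    by (rule conj_add[OF mult_carrier_mat[OF block_diag_carrier[OF c(3)]
        block_diag_carrier[OF c2(1)]] block_diag_carrier[OF c(3)] c(1,2)])
  finally show ?thesis .
qed

text \<open>In the lower block this is \<open>L_N\<close> multiplied by \<open>N\<close> from the
  right; the scalar blocks of \<open>W\<close> and \<open>R\<close> are 0.\<close>

lemma W_eq: "W = Pc * W + R"
proof -
  note c = Sinv_carrier S_carrier L_carrier N_carrier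
  have c2: "L * N \<in> carrier_mat n n" "L * N * N \<in> carrier_mat n n" "L * (L * N) \<in> carrier_mat n n"
    "L * (L * N * N) \<in> carrier_mat n n"
    using c by auto
  have "L * N * N = (L * (L * N) + L) * N"
    by (rule arg_cong[OF L_N, of "\<lambda>X. X * N"])
  also have "\<dots> = L * (L * N * N) + L * N"
    using c c2 by (simp add: add_mult_distrib_mat[of _ n n] assoc_mult_mat[of _ n n _ n _ n])
  finally have e: "L * N * N = L * (L * N * N) + L * N" .
  have "block_diag 1 L * block_diag 0 (L * N * N) + block_diag 0 (L * N)
      = block_diag 0 (L * (L * N * N) + L * N)"
    using block_diag_mult[OF c(3) c2(2), of 1 0] block_diag_add[OF c2(4,1), of 0 0] by simp
  also have "\<dots> = block_diag 0 (L * N * N)"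
    by (simp only: e[symmetric])
  finally have "W = Sinv * (block_diag 1 L * block_diag 0 (L * N * N) + block_diag 0 (L * N)) * S"
    by (simp only: W_def)
  also have "\<dots> = Pc * W + R"
    unfolding R_def Pc_eq W_def conj_mult[OF block_diag_carrier[OF c(3)]
        block_diag_carrier[OF c2(2)] c(1,2) S_Sinv]
    by (rule conj_add[OF mult_carrier_mat[OF block_diag_carrier[OF c(3)]
        block_diag_carrier[OF c2(2)]] block_diag_carrier[OF c2(1)] c(1,2)])
  finally show ?thesis .
qed

lemma D_mat_eq: "D_mat L = block_diag (- 1 / 2) (L * N)"
  using L_carrier by (simp add: D_mat_def block_diag_def N_def)

text \<open>The entry -1/2 of \<open>D_mat L\<close> contributes -1/2 times \<open>J\<close>, by
  \<open>conj_rank_one\<close>; the rest is \<open>R\<close>.\<close>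

lemma Q_entry:
  assumes "r < Suc n" "s < Suc n"
  shows "(Sinv * D_mat L * S) $$ (r, s) = R $$ (r, s) - complex_of_real (\<pi> $ s) / 2"
proof -
  note c = Sinv_carrier S_carrier L_carrier N_carrier
  have c2: "L * N \<in> carrier_mat n n" using c by auto
  have "D_mat L = block_diag (- 1 / 2) (L * N)"
    by (rule D_mat_eq)
  also have "\<dots> = block_diag 0 (L * N) + block_diag (- 1 / 2) (0\<^sub>m n n)"
    using c2 by (simp add: block_diag_add)
  finally have "Sinv * D_mat L * S = R + (- 1 / 2) \<cdot>\<^sub>m J"
    using conj_rank_one[of "- 1 / 2"] c c2
    by (simp add: R_def conj_add[of _ "Suc n"])
  then show ?thesis using assms R_carrier J_carrier by (simp add: J_def)
qed

end

section \<open>One-time and two-time laws of the stationary chain\<close>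

lemma (in prob_space) integral_of_bool:
  assumes "{\<omega> \<in> space M. A \<omega>} \<in> events"
  shows "integrable M (\<lambda>\<omega>. of_bool (A \<omega>) :: real)"
    and "(\<integral>\<omega>. of_bool (A \<omega>) \<partial>M) = \<P>(\<omega> in M. A \<omega>)"
proof -
  have eq: "of_bool (A \<omega>) = indicat_real {\<omega> \<in> space M. A \<omega>} \<omega>" if "\<omega> \<in> space M" for \<omega>
    using that by (simp add: indicator_def)
  have "integrable M (indicat_real {\<omega> \<in> space M. A \<omega>})"
    using assms by (simp add: integrable_indicator_iff emeasure_eq_measure)
  then show "integrable M (\<lambda>\<omega>. of_bool (A \<omega>) :: real)"
    using eq by (subst Bochner_Integration.integrable_cong[OF refl eq]) auto
  have "(\<integral>\<omega>. of_bool (A \<omega>) \<partial>M) = (\<integral>\<omega>. indicat_real {\<omega> \<in> space M. A \<omega>} \<omega> \<partial>M)"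
    using eq by (intro Bochner_Integration.integral_cong) auto
  also have "\<dots> = \<P>(\<omega> in M. A \<omega>)"
    using assms by simp
  finally show "(\<integral>\<omega>. of_bool (A \<omega>) \<partial>M) = \<P>(\<omega> in M. A \<omega>)" .
qed

locale stationary_markov_chain = prob_space M for M :: "'a measure" +
  fixes m :: nat and \<alpha> :: "nat \<Rightarrow> 'b" and P :: "real mat" and \<pi> :: "real vec"
    and X :: "nat \<Rightarrow> 'a \<Rightarrow> 'b"
  assumes inj: "inj_on \<alpha> {..<m}"
    and markov: "markov_chain M m \<alpha> P X"
    and stationary: "stationary_distribution m P \<pi>"
    and initial: "i < m \<Longrightarrow> \<P>(\<omega> in M. X 0 \<omega> = \<alpha> i) = \<pi> $ i"
begin

lemma stochastic: "stochastic_mat m P"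
  and X_measurable: "X n \<in> measurable M (count_space (\<alpha> ` {..<m}))"
  and markov_property: "\<lbrakk>\<forall>i\<le>n. w i < m; j < m; \<P>(\<omega> in M. \<forall>i\<le>n. X i \<omega> = \<alpha> (w i)) > 0\<rbrakk>
    \<Longrightarrow> \<P>(\<omega> in M. X (Suc n) \<omega> = \<alpha> j \<bar> \<forall>i\<le>n. X i \<omega> = \<alpha> (w i)) = P $$ (w n, j)"
proof -
  note mc = markov[unfolded markov_chain_def]
  show "stochastic_mat m P" by (rule mc[THEN conjunct1])
  show "X n \<in> measurable M (count_space (\<alpha> ` {..<m}))"
    by (rule mc[THEN conjunct2, THEN conjunct1, THEN spec])
  show "\<lbrakk>\<forall>i\<le>n. w i < m; j < m; \<P>(\<omega> in M. \<forall>i\<le>n. X i \<omega> = \<alpha> (w i)) > 0\<rbrakk>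
    \<Longrightarrow> \<P>(\<omega> in M. X (Suc n) \<omega> = \<alpha> j \<bar> \<forall>i\<le>n. X i \<omega> = \<alpha> (w i)) = P $$ (w n, j)"
    by (rule mc[THEN conjunct2, THEN conjunct2, THEN spec, THEN spec, THEN spec, THEN mp, THEN mp, THEN mp])
qed

lemma X_range: "\<omega> \<in> space M \<Longrightarrow> \<exists>j<m. X n \<omega> = \<alpha> j"
proof -
  assume "\<omega> \<in> space M"
  then have "X n \<omega> \<in> \<alpha> ` {..<m}"
    using measurable_space[OF X_measurable, of \<omega> n] by simp
  then show ?thesis by blast
qed

lemma X_event: "j < m \<Longrightarrow> {\<omega> \<in> space M. X n \<omega> = \<alpha> j} \<in> events"
proof -
  assume "j < m"
  then have "X n -` {\<alpha> j} \<inter> space M \<in> events"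
    by (intro measurable_sets[OF X_measurable]) simp
  then show ?thesis by (rule back_subst[of "\<lambda>A. A \<in> events"]) auto
qed

lemma X_event_conj:
  assumes "i < m" "j < m"
  shows "{\<omega> \<in> space M. X n \<omega> = \<alpha> i \<and> X k \<omega> = \<alpha> j} \<in> events"
  using sets.Int[OF X_event[OF assms(1), of n] X_event[OF assms(2), of k]]
  by (rule back_subst[of "\<lambda>A. A \<in> events"]) auto

lemma word_event:
  assumes "\<And>i. i \<le> n \<Longrightarrow> w i < m"
  shows "{\<omega> \<in> space M. \<forall>i\<le>n. X i \<omega> = \<alpha> (w i)} \<in> events"
proof -
  have "{\<omega> \<in> space M. \<forall>i\<in>{..n}. X i \<omega> = \<alpha> (w i)} \<in> events"
  proof (rule sets.sets_Collect_finite_All)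
    show "{\<omega> \<in> space M. X i \<omega> = \<alpha> (w i)} \<in> events" if "i \<in> {..n}" for i
      using that by (intro X_event assms) simp
  qed simp
  then show ?thesis by (simp only: Ball_def atMost_iff)
qed

lemma word_event_Suc:
  assumes "\<And>i. i \<le> n \<Longrightarrow> w i < m" "j < m"
  shows "{\<omega> \<in> space M. X (Suc n) \<omega> = \<alpha> j \<and> (\<forall>i\<le>n. X i \<omega> = \<alpha> (w i))} \<in> events"
  using sets.Int[OF X_event[OF assms(2), of "Suc n"] word_event[OF assms(1), of n]]
  by (rule back_subst[of "\<lambda>A. A \<in> events"]) auto

text \<open>The Markov property multiplied out. It is available only for pasts of positive
  probability; for a null past both sides are 0, because the event on the left is contained in the
  past.\<close>

lemma prob_word_Suc:
  assumes w: "\<And>i. i \<le> n \<Longrightarrow> w i < m" and j: "j < m"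
  shows "\<P>(\<omega> in M. X (Suc n) \<omega> = \<alpha> j \<and> (\<forall>i\<le>n. X i \<omega> = \<alpha> (w i)))
       = \<P>(\<omega> in M. \<forall>i\<le>n. X i \<omega> = \<alpha> (w i)) * P $$ (w n, j)" (is "?l = ?q * _")
proof (cases "?q > 0")
  case True
  have "\<forall>i\<le>n. w i < m" using w by blast
  then have "\<P>(\<omega> in M. X (Suc n) \<omega> = \<alpha> j \<bar> \<forall>i\<le>n. X i \<omega> = \<alpha> (w i)) = P $$ (w n, j)"
    using j True by (rule markov_property)
  then show ?thesis using True by (simp add: cond_prob_def field_simps)
next
  case False
  moreover have "0 \<le> ?q" by (rule measure_nonneg)
  ultimately have "?q = 0" by linarith
  have "?l \<le> ?q"
    by (rule finite_measure_mono[OF _ word_event[OF w]]) auto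
  moreover have "0 \<le> ?l" by (rule measure_nonneg)
  ultimately have "?l = 0" using \<open>?q = 0\<close> by linarith
  then show ?thesis using \<open>?q = 0\<close> by simp
qed

text \<open>Words are taken from the extensional function space, so that there are finitely many of
  them and each is determined by its letters up to time \<open>n\<close>.\<close>

lemma word_of_point:
  assumes "\<omega> \<in> space M"
  shows "\<exists>w \<in> {..n} \<rightarrow>\<^sub>E {..<m}. \<forall>i\<le>n. X i \<omega> = \<alpha> (w i)"
proof -
  obtain f where f: "\<And>i. f i < m \<and> X i \<omega> = \<alpha> (f i)"
    using X_range[OF assms] by metis
  then show ?thesis
    by (intro bexI[of _ "restrict f {..n}"]) auto
qed

lemma words_disjoint:
  assumes "w \<in> {..n} \<rightarrow>\<^sub>E {..<m}" "w' \<in> {..n} \<rightarrow>\<^sub>E {..<m}"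
    and "\<forall>i\<le>n. X i \<omega> = \<alpha> (w i)" "\<forall>i\<le>n. X i \<omega> = \<alpha> (w' i)"
  shows "w = w'"
proof (rule PiE_ext[OF assms(1,2)])
  fix i assume i: "i \<in> {..n}"
  then have "\<alpha> (w i) = \<alpha> (w' i)" using assms(3,4) by (metis atMost_iff)
  moreover have "w i \<in> {..<m}" "w' i \<in> {..<m}"
    using assms(1,2) i by (auto dest!: PiE_mem)
  ultimately show "w i = w' i" using inj by (auto dest: inj_onD)
qed

text \<open>The event on times \<open>i\<close> and \<open>n\<close> is the disjoint union of the
  words with \<open>w i = r\<close> and \<open>w n = t\<close>. Each of them ends in
  \<open>t\<close>, so \<open>prob_word_Suc\<close> gives all of them the same factor
  \<open>P $$ (t, s)\<close>.\<close>

lemma prob_triple: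
  assumes "i \<le> n" "r < m" "t < m" "s < m"
  shows "\<P>(\<omega> in M. X i \<omega> = \<alpha> r \<and> X n \<omega> = \<alpha> t \<and> X (Suc n) \<omega> = \<alpha> s)
       = \<P>(\<omega> in M. X i \<omega> = \<alpha> r \<and> X n \<omega> = \<alpha> t) * P $$ (t, s)"
proof -
  define Wd where "Wd = {w \<in> {..n} \<rightarrow>\<^sub>E {..<m}. w i = r \<and> w n = t}"
  define A where "A w = {\<omega> \<in> space M. \<forall>l\<le>n. X l \<omega> = \<alpha> (w l)}" for w
  define B where "B w = {\<omega> \<in> space M. X (Suc n) \<omega> = \<alpha> s \<and> (\<forall>l\<le>n. X l \<omega> = \<alpha> (w l))}" for w
  have fin: "finite Wd"
    unfolding Wd_def by (rule finite_subset[OF _ finite_PiE[of "{..n}" "\<lambda>_. {..<m}"]]) blast+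
  have lt: "w l < m" if "w \<in> Wd" "l \<le> n" for w l
    using that PiE_mem[of w "{..n}" "\<lambda>_. {..<m}" l] unfolding Wd_def by simp
  have ev: "A w \<in> events" "B w \<in> events" if "w \<in> Wd" for w
    unfolding A_def B_def using word_event[of n w] word_event_Suc[of n w s] lt[OF that] assms(4)
    by blast+
  have dj: "disjoint_family_on A Wd" "disjoint_family_on B Wd"
    using words_disjoint[of _ n] unfolding disjoint_family_on_def A_def B_def Wd_def by blast+
  have word: "\<exists>w\<in>Wd. \<omega> \<in> A w"
    if \<omega>: "\<omega> \<in> space M" "X i \<omega> = \<alpha> r" "X n \<omega> = \<alpha> t" for \<omega>
  proof -
    obtain w where w: "w \<in> {..n} \<rightarrow>\<^sub>E {..<m}" "\<forall>l\<le>n. X l \<omega> = \<alpha> (w l)"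
      using word_of_point[OF \<omega>(1)] by blast
    have "w i \<in> {..<m}" "w n \<in> {..<m}" "\<alpha> (w i) = \<alpha> r" "\<alpha> (w n) = \<alpha> t"
      using w assms(1) \<omega> PiE_mem[OF w(1)] by auto
    then have "w i = r" "w n = t" using inj assms by (auto dest: inj_onD)
    with w \<omega> show ?thesis by (auto simp: Wd_def A_def)
  qed
  have AU: "{\<omega> \<in> space M. X i \<omega> = \<alpha> r \<and> X n \<omega> = \<alpha> t} = (\<Union>w\<in>Wd. A w)"
    using word assms(1) by (auto simp: A_def Wd_def)
  have BU: "{\<omega> \<in> space M. X i \<omega> = \<alpha> r \<and> X n \<omega> = \<alpha> t \<and> X (Suc n) \<omega> = \<alpha> s} = (\<Union>w\<in>Wd. B w)"
    (is "?L = ?R")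
  proof
    show "?L \<subseteq> ?R" using word unfolding A_def B_def by blast
    show "?R \<subseteq> ?L" using assms(1) by (auto simp: B_def Wd_def)
  qed
  have "prob (\<Union>w\<in>Wd. B w) = (\<Sum>w\<in>Wd. prob (B w))"
    by (rule finite_measure_finite_Union[OF fin _ dj(2)]) (use ev in auto)
  also have "\<dots> = (\<Sum>w\<in>Wd. prob (A w) * P $$ (t, s))"
  proof (rule sum.cong)
    fix w assume w: "w \<in> Wd"
    have "prob (B w) = prob (A w) * P $$ (w n, s)"
      unfolding A_def B_def by (rule prob_word_Suc) (use lt[OF w] assms in auto)
    then show "prob (B w) = prob (A w) * P $$ (t, s)" using w by (simp add: Wd_def)
  qed simp
  also have "\<dots> = prob (\<Union>w\<in>Wd. A w) * P $$ (t, s)"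
    by (subst finite_measure_finite_Union[OF fin _ dj(1)])
      (use ev in \<open>auto simp: sum_distrib_right\<close>)
  finally show ?thesis unfolding AU BU .
qed

lemma X_triple_event:
  assumes "i < m" "j < m" "k < m"
  shows "{\<omega> \<in> space M. X a \<omega> = \<alpha> i \<and> X b \<omega> = \<alpha> j \<and> X c \<omega> = \<alpha> k} \<in> events"
  using sets.Int[OF X_event[OF assms(1), of a] X_event_conj[OF assms(2,3), of b c]]
  by (rule back_subst[of "\<lambda>A. A \<in> events"]) auto

text \<open>A Chapman-Kolmogorov step: the event is split according to the letter at time
  \<open>n\<close>.\<close>

lemma prob_pair_Suc:
  assumes "i \<le> n" "r < m" "s < m"
  shows "\<P>(\<omega> in M. X i \<omega> = \<alpha> r \<and> X (Suc n) \<omega> = \<alpha> s)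
       = (\<Sum>t<m. \<P>(\<omega> in M. X i \<omega> = \<alpha> r \<and> X n \<omega> = \<alpha> t) * P $$ (t, s))"
proof -
  define A where "A t = {\<omega> \<in> space M. X i \<omega> = \<alpha> r \<and> X n \<omega> = \<alpha> t \<and> X (Suc n) \<omega> = \<alpha> s}" for t
  have "disjoint_family_on A {..<m}"
    using inj unfolding disjoint_family_on_def A_def inj_on_def by force
  moreover have "A ` {..<m} \<subseteq> events"
    unfolding A_def using X_triple_event[OF assms(2) _ assms(3)] by auto
  ultimately have "prob (\<Union>t<m. A t) = (\<Sum>t<m. prob (A t))"
    by (intro finite_measure_finite_Union) auto
  also have "(\<Union>t<m. A t) = {\<omega> \<in> space M. X i \<omega> = \<alpha> r \<and> X (Suc n) \<omega> = \<alpha> s}"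
    using X_range[of _ n] by (auto simp: A_def)
  finally show ?thesis
    using assms by (simp add: A_def prob_triple)
qed

text \<open>The law at time \<open>n + 1\<close> is the law at time \<open>n\<close> times
  \<open>P\<close>, and \<open>\<pi>\<close> is invariant under that step.\<close>

lemma prob_single: "s < m \<Longrightarrow> \<P>(\<omega> in M. X n \<omega> = \<alpha> s) = \<pi> $ s"
proof (induction n arbitrary: s)
  case 0
  then show ?case by (rule initial)
next
  case (Suc n)
  define A where "A t = {\<omega> \<in> space M. X n \<omega> = \<alpha> t \<and> X (Suc n) \<omega> = \<alpha> s}" for t
  have "disjoint_family_on A {..<m}"
    using inj unfolding disjoint_family_on_def A_def inj_on_def by force
  moreover have "A ` {..<m} \<subseteq> events"
    unfolding A_def using X_event_conj Suc.prems by auto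
  ultimately have "prob (\<Union>t<m. A t) = (\<Sum>t<m. prob (A t))"
    by (intro finite_measure_finite_Union) auto
  also have "(\<Union>t<m. A t) = {\<omega> \<in> space M. X (Suc n) \<omega> = \<alpha> s}"
    using X_range[of _ n] by (auto simp: A_def)
  also have "(\<Sum>t<m. prob (A t)) = (\<Sum>t<m. \<pi> $ t * P $$ (t, s))"
  proof (rule sum.cong)
    fix t assume "t \<in> {..<m}"
    then have t: "t < m" by simp
    have "prob (A t) = \<P>(\<omega> in M. X n \<omega> = \<alpha> t) * P $$ (t, s)"
      \<comment> \<open>With \<open>i = n\<close> and both letters equal to \<open>t\<close>, the
        two conditions on the past collapse into one.\<close>
      using prob_triple[OF order_refl t t Suc.prems, of n] by (simp add: A_def)
    then show "prob (A t) = \<pi> $ t * P $$ (t, s)" by (simp add: Suc.IH[OF t])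
  qed simp
  also have "\<dots> = \<pi> $ s"
    using stationary Suc.prems by (simp add: stationary_distribution_def)
  finally show ?case .
qed

lemma prob_pair:
  assumes "r < m" "s < m"
  shows "\<P>(\<omega> in M. X i \<omega> = \<alpha> r \<and> X (i + d) \<omega> = \<alpha> s) = \<pi> $ r * (P ^\<^sub>m d) $$ (r, s)"
  using assms(2)
proof (induction d arbitrary: s)
  case 0
  have P: "P \<in> carrier_mat m m" using stochastic by (rule stochastic_mat_carrier)
  show ?case
  proof (cases "r = s")
    case True
    then show ?thesis using prob_single[OF assms(1), of i] P assms(1) by simp
  next
    case False
    then have "\<alpha> r \<noteq> \<alpha> s"
      using inj assms(1) 0 unfolding inj_on_def by auto
    then have e: "{\<omega> \<in> space M. X i \<omega> = \<alpha> r \<and> X (i + 0) \<omega> = \<alpha> s} = {}"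
      by auto
    show ?thesis unfolding e using False P assms(1) 0 by simp
  qed
next
  case (Suc d)
  note carr = stochastic_mat_carrier[OF stochastic_mat_pow[OF stochastic, of d]]
    stochastic_mat_carrier[OF stochastic]
  have "\<P>(\<omega> in M. X i \<omega> = \<alpha> r \<and> X (i + Suc d) \<omega> = \<alpha> s)
      = (\<Sum>t<m. \<pi> $ r * (P ^\<^sub>m d) $$ (r, t) * P $$ (t, s))"
    using prob_pair_Suc[of i "i + d" r s] assms Suc by simp
  also have "\<dots> = \<pi> $ r * (P ^\<^sub>m Suc d) $$ (r, s)"
    using mult_mat_entry[OF carr assms(1) Suc.prems] by (simp add: sum_distrib_left mult.assoc)
  finally show ?case .
qed

section \<open>The covariance of the counts and its increment in \<open>k\<close>\<close>

lemma centered_count_eq_sum: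
  "centered_count \<alpha> \<pi> X r k \<omega> = (\<Sum>i\<in>{1..k}. of_bool (X i \<omega> = \<alpha> r) - \<pi> $ r)"
proof -
  have "{i \<in> {1..k}. X i \<omega> = \<alpha> r} = {1..k} \<inter> {i. X i \<omega> = \<alpha> r}" by auto
  then show ?thesis
    by (simp add: centered_count_def occurrences_def sum_subtractf sum_of_bool_eq mult.commute)
qed

text \<open>By \<open>prob_single\<close> every summand
  \<open>of_bool (X i \<omega> = \<alpha> r) - \<pi> $ r\<close> has mean 0. The covariance is
  therefore the expectation of a product of two sums, which expands over pairs of times.\<close>

lemma covariance_centered_count:
  assumes r: "r < m" and s: "s < m"
  shows "covariance M (centered_count \<alpha> \<pi> X r k) (centered_count \<alpha> \<pi> X s k)
    = (\<Sum>i\<in>{1..k}. \<Sum>j\<in>{1..k}. \<P>(\<omega> in M. X i \<omega> = \<alpha> r \<and> X j \<omega> = \<alpha> s) - \<pi> $ r * \<pi> $ s)"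
proof -
  let ?I = "\<lambda>r i \<omega>. of_bool (X i \<omega> = \<alpha> r) :: real"
  have int: "integrable M (?I r i)" "(\<integral>\<omega>. ?I r i \<omega> \<partial>M) = \<pi> $ r" if "r < m" for r i
    using integral_of_bool[OF X_event[OF that, of i]] prob_single[OF that] by auto
  have mean: "(\<integral>\<omega>. centered_count \<alpha> \<pi> X r k \<omega> \<partial>M) = 0" if "r < m" for r
    unfolding centered_count_eq_sum using int[OF that] by (simp add: prob_space)
  have prod: "integrable M (\<lambda>\<omega>. (?I r i \<omega> - \<pi> $ r) * (?I s j \<omega> - \<pi> $ s))"
    "(\<integral>\<omega>. (?I r i \<omega> - \<pi> $ r) * (?I s j \<omega> - \<pi> $ s) \<partial>M)
      = \<P>(\<omega> in M. X i \<omega> = \<alpha> r \<and> X j \<omega> = \<alpha> s) - \<pi> $ r * \<pi> $ s" for i j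
  proof -
    have e: "(?I r i \<omega> - \<pi> $ r) * (?I s j \<omega> - \<pi> $ s)
        = of_bool (X i \<omega> = \<alpha> r \<and> X j \<omega> = \<alpha> s) - ?I r i \<omega> * \<pi> $ s - \<pi> $ r * ?I s j \<omega>
          + \<pi> $ r * \<pi> $ s" for \<omega>
      by (simp add: algebra_simps of_bool_conj)
    note b = integral_of_bool[OF X_event_conj[OF r s, of i j]]
    show "integrable M (\<lambda>\<omega>. (?I r i \<omega> - \<pi> $ r) * (?I s j \<omega> - \<pi> $ s))"
      unfolding e using int[OF r] int[OF s] b by simp
    show "(\<integral>\<omega>. (?I r i \<omega> - \<pi> $ r) * (?I s j \<omega> - \<pi> $ s) \<partial>M)
      = \<P>(\<omega> in M. X i \<omega> = \<alpha> r \<and> X j \<omega> = \<alpha> s) - \<pi> $ r * \<pi> $ s"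
      unfolding e using int[OF r] int[OF s] b by (simp add: prob_space)
  qed
  have "covariance M (centered_count \<alpha> \<pi> X r k) (centered_count \<alpha> \<pi> X s k)
      = (\<integral>\<omega>. (\<Sum>i\<in>{1..k}. \<Sum>j\<in>{1..k}. (?I r i \<omega> - \<pi> $ r) * (?I s j \<omega> - \<pi> $ s)) \<partial>M)"
    unfolding covariance_def mean[OF r] mean[OF s] unfolding centered_count_eq_sum
    by (simp only: sum_product diff_0_right)
  also have "\<dots> = (\<Sum>i\<in>{1..k}. \<Sum>j\<in>{1..k}.
      \<P>(\<omega> in M. X i \<omega> = \<alpha> r \<and> X j \<omega> = \<alpha> s) - \<pi> $ r * \<pi> $ s)"
    using prod by (simp add: Bochner_Integration.integral_sum)
  finally show ?thesis .
qed

end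

context stationary_markov_chain
begin

text \<open>The square of time pairs gains a corner and two edges. The corner gives the constant;
  each edge pairs the new time \<open>Suc k\<close> with all earlier times.\<close>

lemma covariance_centered_count_Suc:
  assumes r: "r < m" and s: "s < m"
  shows "covariance M (centered_count \<alpha> \<pi> X r (Suc k)) (centered_count \<alpha> \<pi> X s (Suc k))
    = covariance M (centered_count \<alpha> \<pi> X r k) (centered_count \<alpha> \<pi> X s k)
      + (if r = s then \<pi> $ r else 0) - \<pi> $ r * \<pi> $ s
      + \<pi> $ r * (\<Sum>d<k. (P ^\<^sub>m Suc d) $$ (r, s) - \<pi> $ s)
      + \<pi> $ s * (\<Sum>d<k. (P ^\<^sub>m Suc d) $$ (s, r) - \<pi> $ r)"
proof -
  define c where "c r s i j = \<P>(\<omega> in M. X i \<omega> = \<alpha> r \<and> X j \<omega> = \<alpha> s) - \<pi> $ r * \<pi> $ s"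
    for r s i j
  \<comment> \<open>\<open>prob_pair\<close> runs forward in time. On the edge where the letter
    \<open>r\<close> sits at the later time, the roles are exchanged, so transitions lead from
    \<open>s\<close> to \<open>r\<close>.\<close>
  have swap: "c r s i j = c s r j i" for i j
    by (simp add: c_def conj_commute mult.commute)
  have off: "(\<Sum>i\<in>{1..k}. c r s i (Suc k)) = \<pi> $ r * (\<Sum>d<k. (P ^\<^sub>m Suc d) $$ (r, s) - \<pi> $ s)"
    if "r < m" "s < m" for r s
  proof -
    have "(\<Sum>i\<in>{1..k}. c r s i (Suc k)) = (\<Sum>d<k. c r s (k - d) (Suc k))"
      \<comment> \<open>With \<open>d = k - i\<close>, time \<open>i\<close> lies
        \<open>Suc d\<close> steps before \<open>Suc k\<close>; hence the exponent
        \<open>Suc d\<close> and the range \<open>d < k\<close>.\<close>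
      by (rule sum.reindex_bij_witness[of _ "\<lambda>d. k - d" "\<lambda>i. k - i"]) auto
    also have "\<dots> = (\<Sum>d<k. \<pi> $ r * ((P ^\<^sub>m Suc d) $$ (r, s) - \<pi> $ s))"
    proof (rule sum.cong)
      fix d assume "d \<in> {..<k}"
      then have d: "k - d + Suc d = Suc k" by simp
      show "c r s (k - d) (Suc k) = \<pi> $ r * ((P ^\<^sub>m Suc d) $$ (r, s) - \<pi> $ s)"
        using prob_pair[OF that, of "k - d" "Suc d"]
        unfolding d c_def by (simp only: right_diff_distrib)
    qed simp
    finally show ?thesis by (simp only: sum_distrib_left)
  qed
  have P: "P \<in> carrier_mat m m" using stochastic by (rule stochastic_mat_carrier)
  have diag: "c r s (Suc k) (Suc k) = (if r = s then \<pi> $ r else 0) - \<pi> $ r * \<pi> $ s"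
    using prob_pair[OF r s, of "Suc k" 0] P r s by (simp add: c_def)
  have ins: "{1..Suc k} = insert (Suc k) {1..k}" "Suc k \<notin> {1..k}"
    by auto
  have "(\<Sum>i\<in>{1..Suc k}. \<Sum>j\<in>{1..Suc k}. c r s i j)
      = (\<Sum>i\<in>{1..k}. \<Sum>j\<in>{1..k}. c r s i j) + c r s (Suc k) (Suc k)
        + (\<Sum>i\<in>{1..k}. c r s i (Suc k)) + (\<Sum>j\<in>{1..k}. c r s (Suc k) j)"
    unfolding ins(1) using ins(2) by (simp add: sum.distrib)
  also have "(\<Sum>j\<in>{1..k}. c r s (Suc k) j) = (\<Sum>j\<in>{1..k}. c s r j (Suc k))"
    by (intro sum.cong swap refl)
  finally show ?thesis
    unfolding covariance_centered_count[OF r s] off[OF r s] off[OF s r] diag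
    by (simp add: c_def)
qed

end

section \<open>Telescoping sums of powers of \<open>P\<close>\<close>

context left_jordan_chain
begin

text \<open>Powers are taken over the reals and then embedded, so that the stochasticity of
  \<open>P ^\<^sub>m k\<close> remains directly usable.\<close>

definition "Ppow k = map_mat complex_of_real (P ^\<^sub>m k)"

lemma P_carrier: "P \<in> carrier_mat (Suc n) (Suc n)"
  using stoch by (rule stochastic_mat_carrier)

lemma Ppow_carrier: "Ppow k \<in> carrier_mat (Suc n) (Suc n)"
  using P_carrier by (simp add: Ppow_def)

lemma Ppow_Suc: "Ppow (Suc k) = Ppow k * Pc"
  unfolding Ppow_def pow_mat.simps
  by (rule of_real_hom.mat_hom_mult[OF pow_carrier_mat[OF P_carrier] P_carrier])

lemma Ppow_0: "Ppow 0 = 1\<^sub>m (Suc n)"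
  using P_carrier by (auto simp: Ppow_def)

lemma Ppow_entry:
  "r < Suc n \<Longrightarrow> s < Suc n \<Longrightarrow> Ppow k $$ (r, s) = complex_of_real ((P ^\<^sub>m k) $$ (r, s))"
  using carrier_matD[OF pow_carrier_mat[OF P_carrier, of k]] by (simp add: Ppow_def)

text \<open>All rows of \<open>J\<close> coincide, and each row of \<open>Ppow k\<close> sums to
  1.\<close>

lemma Ppow_J: "Ppow k * J = J"
proof (rule eq_matI)
  show "dim_row (Ppow k * J) = dim_row J" "dim_col (Ppow k * J) = dim_col J"
    using Ppow_carrier[of k] by (simp_all add: J_def)
  fix r s assume "r < dim_row J" "s < dim_col J"
  then have rs: "r < Suc n" "s < Suc n" by (simp_all add: J_def)
  have "(Ppow k * J) $$ (r, s) = (\<Sum>l<Suc n. Ppow k $$ (r, l) * J $$ (l, s))"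
    by (rule mult_mat_entry[OF Ppow_carrier J_carrier rs])
  also have "\<dots> = (\<Sum>l<Suc n. complex_of_real ((P ^\<^sub>m k) $$ (r, l)) * complex_of_real (\<pi> $ s))"
    by (rule sum.cong) (use rs in \<open>simp_all add: Ppow_entry J_def\<close>)
  also have "\<dots> = complex_of_real (\<Sum>l<Suc n. (P ^\<^sub>m k) $$ (r, l)) * complex_of_real (\<pi> $ s)"
    by (simp only: sum_distrib_right of_real_sum)
  also have "(\<Sum>l<Suc n. (P ^\<^sub>m k) $$ (r, l)) = 1"
    using stochastic_mat_pow[OF stoch, of k] rs unfolding stochastic_mat_def by blast
  finally show "(Ppow k * J) $$ (r, s) = J $$ (r, s)"
    using rs by (simp add: J_def)
qed

text \<open>Multiplying \<open>R_eq\<close> by \<open>Ppow k\<close> gives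
  \<open>P^k R - P^(k+1) R = P^(k+1) - J\<close>, so the sum telescopes.\<close>

lemma sum_power_deviations:
  assumes rs: "r < Suc n" "s < Suc n"
  shows "(\<Sum>d<k. complex_of_real ((P ^\<^sub>m Suc d) $$ (r, s) - \<pi> $ s))
    = R $$ (r, s) - (Ppow k * R) $$ (r, s)"
proof (induction k)
  case 0
  show ?case using R_carrier by (simp add: Ppow_0)
next
  case (Suc k)
  have "Ppow k * R + J = Ppow k * (R + J)"
    unfolding mult_add_distrib_mat[OF Ppow_carrier R_carrier J_carrier] Ppow_J ..
  also have "\<dots> = Ppow (Suc k) * R + Ppow (Suc k)"
    unfolding R_eq Ppow_Suc mult_add_distrib_mat[OF Ppow_carrier mult_carrier_mat[OF Pc_carrier R_carrier] Pc_carrier]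
      assoc_mult_mat[OF Ppow_carrier Pc_carrier R_carrier] ..
  finally have "(Ppow k * R + J) $$ (r, s) = (Ppow (Suc k) * R + Ppow (Suc k)) $$ (r, s)"
    by (rule arg_cong)
  then have "(Ppow k * R) $$ (r, s) + complex_of_real (\<pi> $ s)
      = (Ppow (Suc k) * R) $$ (r, s) + complex_of_real ((P ^\<^sub>m Suc k) $$ (r, s))"
    using rs J_carrier Ppow_carrier[of "Suc k"] Ppow_entry[OF rs, of "Suc k"]
    by (simp add: J_def del: pow_mat.simps)
  then show ?case
    unfolding sum.lessThan_Suc Suc.IH by (simp add: algebra_simps del: pow_mat.simps)
qed

text \<open>The same telescoping for \<open>W_eq\<close>:
  \<open>P^j R = P^j W - P^(j+1) W\<close>.\<close>

lemma sum_Ppow_R: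
  assumes rs: "r < Suc n" "s < Suc n"
  shows "(\<Sum>j<k. (Ppow j * R) $$ (r, s)) = W $$ (r, s) - (Ppow k * W) $$ (r, s)"
proof (induction k)
  case 0
  show ?case using W_carrier by (simp add: Ppow_0)
next
  case (Suc k)
  have "Ppow k * W = Ppow k * (Pc * W + R)"
    by (rule arg_cong[OF W_eq])
  also have "\<dots> = Ppow (Suc k) * W + Ppow k * R"
    unfolding Ppow_Suc mult_add_distrib_mat[OF Ppow_carrier mult_carrier_mat[OF Pc_carrier W_carrier] R_carrier]
      assoc_mult_mat[OF Ppow_carrier Pc_carrier W_carrier] ..
  finally have "(Ppow k * W) $$ (r, s) = (Ppow (Suc k) * W + Ppow k * R) $$ (r, s)"
    by (rule arg_cong)
  then have "(Ppow k * W) $$ (r, s) = (Ppow (Suc k) * W) $$ (r, s) + (Ppow k * R) $$ (r, s)"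
    using rs carrier_matD[OF Ppow_carrier[of k]] carrier_matD[OF R_carrier] by simp
  then show ?case
    unfolding sum.lessThan_Suc Suc.IH by (simp add: algebra_simps)
qed

text \<open>The entries of a stochastic matrix lie between 0 and 1. The bound is uniform in
  \<open>k\<close>, which is what keeps the error in the covariance bounded.\<close>

lemma norm_Ppow_W_le:
  assumes rs: "r < Suc n" "s < Suc n"
  shows "norm ((Ppow k * W) $$ (r, s)) \<le> (\<Sum>l<Suc n. norm (W $$ (l, s)))"
proof -
  have st: "stochastic_mat (Suc n) (P ^\<^sub>m k)" by (rule stochastic_mat_pow[OF stoch])
  have ge: "0 \<le> (P ^\<^sub>m k) $$ (r, l)" if "l < Suc n" for l
    using st rs that unfolding stochastic_mat_def by blast
  have le: "(P ^\<^sub>m k) $$ (r, l) \<le> 1" if l: "l < Suc n" for l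
  proof -
    have "(P ^\<^sub>m k) $$ (r, l) \<le> (\<Sum>l<Suc n. (P ^\<^sub>m k) $$ (r, l))"
      by (rule member_le_sum) (use l ge in auto)
    also have "\<dots> = 1"
      using st rs unfolding stochastic_mat_def by blast
    finally show ?thesis .
  qed
  have "norm ((Ppow k * W) $$ (r, s)) = norm (\<Sum>l<Suc n. Ppow k $$ (r, l) * W $$ (l, s))"
    by (simp only: mult_mat_entry[OF Ppow_carrier W_carrier rs])
  also have "\<dots> \<le> (\<Sum>l<Suc n. norm (Ppow k $$ (r, l) * W $$ (l, s)))"
    by (rule norm_sum)
  also have "\<dots> \<le> (\<Sum>l<Suc n. norm (W $$ (l, s)))"
  proof (rule sum_mono)
    fix l assume "l \<in> {..<Suc n}"
    then have l: "l < Suc n" by simp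
    have "norm (Ppow k $$ (r, l)) \<le> 1"
      unfolding Ppow_entry[OF rs(1) l] using ge[OF l] le[OF l] by simp
    then show "norm (Ppow k $$ (r, l) * W $$ (l, s)) \<le> norm (W $$ (l, s))"
      unfolding norm_mult by (intro mult_left_le_one_le) auto
  qed
  finally show ?thesis .
qed

end

section \<open>Linear growth of the covariance and the limit\<close>

lemma tendsto_linear_plus_bounded_over_n:
  fixes E :: "nat \<Rightarrow> complex"
  assumes "\<And>k. norm (E k) \<le> B"
  shows "(\<lambda>k. (of_nat k * a + E k) / of_nat k) \<longlonglongrightarrow> a"
proof -
  have "(\<lambda>k. E k / of_nat k) \<longlonglongrightarrow> 0"
  proof (rule Lim_null_comparison)
    show "\<forall>\<^sub>F k in sequentially. norm (E k / of_nat k) \<le> B / real k"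
      using assms by (intro always_eventually allI) (simp add: norm_divide divide_right_mono)
    show "(\<lambda>k. B / real k) \<longlonglongrightarrow> 0"
      by (rule lim_const_over_n)
  qed
  then have "(\<lambda>k. a + E k / of_nat k) \<longlonglongrightarrow> a + 0"
    by (intro tendsto_add tendsto_const)
  moreover have "\<forall>\<^sub>F k in sequentially. a + E k / of_nat k = (of_nat k * a + E k) / of_nat k"
    \<comment> \<open>Equality is claimed only eventually: at \<open>k = 0\<close> division by zero
      makes the left side \<open>a\<close> and the right side 0.\<close>
    using eventually_gt_at_top[of "0::nat"] by eventually_elim (simp add: add_divide_distrib)
  ultimately show ?thesis
    by (simp add: tendsto_cong)
qed

locale stationary_jordan_chain =
  stationary_markov_chain M "Suc n" \<alpha> P \<pi> X + left_jordan_chain n P \<pi> Sinv L S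
  for M :: "'a measure" and n \<alpha> P \<pi> X Sinv L S
begin

text \<open>The increment of the covariance, with the edge sums \<open>R - P^k R\<close> replaced by
  \<open>R\<close>.\<close>

definition "rate r s = (if r = s then complex_of_real (\<pi> $ r) else 0)
  - complex_of_real (\<pi> $ r) * complex_of_real (\<pi> $ s)
  + complex_of_real (\<pi> $ r) * R $$ (r, s) + complex_of_real (\<pi> $ s) * R $$ (s, r)"

text \<open>Each increment is \<open>rate r s\<close> minus the weighted entries of
  \<open>P^k R\<close>. Summed over the steps, these corrections become \<open>W - P^k W\<close>, so
  the formula is exact for every \<open>k\<close>.\<close>

lemma covariance_closed_form:
  assumes r: "r < Suc n" and s: "s < Suc n"
  shows "complex_of_real (covariance M (centered_count \<alpha> \<pi> X r k) (centered_count \<alpha> \<pi> X s k))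
    = of_nat k * rate r s
      - complex_of_real (\<pi> $ r) * (W $$ (r, s) - (Ppow k * W) $$ (r, s))
      - complex_of_real (\<pi> $ s) * (W $$ (s, r) - (Ppow k * W) $$ (s, r))"
  \<comment> \<open>The \<open>W\<close> terms are turned back into sums over \<open>j < k\<close>,
    so that the induction step only adds the summand for \<open>j = k\<close>.\<close>
  unfolding sum_Ppow_R[OF r s, symmetric] sum_Ppow_R[OF s r, symmetric]
proof (induction k)
  case 0
  show ?case using covariance_centered_count[OF r s, of 0] by simp
next
  case (Suc k)
  have "complex_of_real
      (covariance M (centered_count \<alpha> \<pi> X r (Suc k)) (centered_count \<alpha> \<pi> X s (Suc k)))
    = complex_of_real (covariance M (centered_count \<alpha> \<pi> X r k) (centered_count \<alpha> \<pi> X s k))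
      + (if r = s then complex_of_real (\<pi> $ r) else 0)
      - complex_of_real (\<pi> $ r) * complex_of_real (\<pi> $ s)
      + complex_of_real (\<pi> $ r) * (\<Sum>d<k. complex_of_real ((P ^\<^sub>m Suc d) $$ (r, s) - \<pi> $ s))
      + complex_of_real (\<pi> $ s) * (\<Sum>d<k. complex_of_real ((P ^\<^sub>m Suc d) $$ (s, r) - \<pi> $ r))"
    unfolding covariance_centered_count_Suc[OF r s]
    by (simp only: of_real_add of_real_diff of_real_mult of_real_sum if_distrib[of complex_of_real] of_real_0)
  then show ?case
    unfolding sum_power_deviations[OF r s] sum_power_deviations[OF s r] Suc.IH
      sum.lessThan_Suc rate_def
    by (simp add: algebra_simps)
qed

lemma covariance_over_n_tendsto:
  assumes r: "r < Suc n" and s: "s < Suc n"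
  shows "(\<lambda>k. complex_of_real
      (covariance M (centered_count \<alpha> \<pi> X r k) (centered_count \<alpha> \<pi> X s k) / real k))
    \<longlonglongrightarrow> rate r s"
proof -
  define F where "F r s k = complex_of_real (\<pi> $ r) * (W $$ (r, s) - (Ppow k * W) $$ (r, s))"
    for r s k
  \<comment> \<open>A bound for \<open>F r s k\<close> that does not depend on \<open>k\<close>,
    obtained from \<open>norm_Ppow_W_le\<close> and the triangle inequality.\<close>
  define K where "K r s = norm (complex_of_real (\<pi> $ r)) *
    (norm (W $$ (r, s)) + (\<Sum>l<Suc n. norm (W $$ (l, s))))" for r s
  have F: "norm (F r s k) \<le> K r s" if "r < Suc n" "s < Suc n" for r s k
    unfolding F_def K_def norm_mult
    by (intro mult_left_mono norm_ge_zero order_trans[OF norm_triangle_ineq4]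
        add_left_mono norm_Ppow_W_le that)
  have "norm (- F r s k - F s r k) \<le> K r s + K s r" for k
    using norm_triangle_ineq4[of "- F r s k" "F s r k"] F[OF r s, of k] F[OF s r, of k] by simp
  then have "(\<lambda>k. (of_nat k * rate r s + (- F r s k - F s r k)) / of_nat k) \<longlonglongrightarrow> rate r s"
    by (rule tendsto_linear_plus_bounded_over_n)
  moreover have "of_nat k * rate r s + (- F r s k - F s r k)
      = complex_of_real (covariance M (centered_count \<alpha> \<pi> X r k) (centered_count \<alpha> \<pi> X s k))" for k
    unfolding covariance_closed_form[OF r s] F_def by simp
  ultimately show ?thesis by simp
qed

end

section \<open>Entries of the covariance matrix and conclusion\<close>

lemma std_form_eq_entry:
  assumes "A \<in> carrier_mat m m" "r < m" "s < m"
  shows "std_form m r A s = A $$ (r, s)"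
  using assms by (simp add: std_form_def)

text \<open>Multiplication by the diagonal matrix scales rows from the left and columns from the
  right, so each product sum has a single nonzero term.\<close>

lemma Sigma_mat_entry:
  assumes Q: "Q \<in> carrier_mat m m" and r: "r < m" and s: "s < m"
  shows "Sigma_mat m \<pi> Q $$ (r, s) = (if r = s then complex_of_real (\<pi> $ r) else 0)
    + complex_of_real (\<pi> $ r) * Q $$ (r, s) + complex_of_real (\<pi> $ s) * Q $$ (s, r)"
proof -
  have Pi: "Pi_mat m \<pi> \<in> carrier_mat m m" by (simp add: Pi_mat_def)
  have QT: "transpose_mat Q \<in> carrier_mat m m" using Q by simp
  have "(Pi_mat m \<pi> * Q) $$ (r, s)
      = (\<Sum>l<m. if l = r then complex_of_real (\<pi> $ r) * Q $$ (r, s) else 0)"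
    unfolding mult_mat_entry[OF Pi Q r s] by (rule sum.cong) (use r in \<open>auto simp: Pi_mat_def\<close>)
  moreover have "(transpose_mat Q * Pi_mat m \<pi>) $$ (r, s)
      = (\<Sum>l<m. if l = s then complex_of_real (\<pi> $ s) * Q $$ (s, r) else 0)"
    unfolding mult_mat_entry[OF QT Pi r s]
    by (rule sum.cong) (use r s Q in \<open>auto simp: Pi_mat_def\<close>)
  ultimately show ?thesis
    using r s Pi Q QT by (simp add: Sigma_mat_def) (simp add: Pi_mat_def)
qed

theorem theorem2p1:
  fixes M :: "'a measure"
    and m :: nat
    and \<alpha> :: "nat \<Rightarrow> 'b :: linorder"
    and X :: "nat \<Rightarrow> 'a \<Rightarrow> 'b"
    and P :: "real mat"
    and \<pi> :: "real vec"
    and Sinv L S Q :: "complex mat"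
    and T :: "nat \<Rightarrow> nat \<Rightarrow> 'a \<Rightarrow> real"
  assumes "prob_space M"
    and "strict_mono_on {..<m} \<alpha>"
    and "markov_chain M m \<alpha> P X"
    and "irreducible_chain m P"
    and "aperiodic_chain m P"
    and "stationary_distribution m P \<pi>"
    and "\<forall>i<m. \<P>(\<omega> in M. X 0 \<omega> = \<alpha> i) = \<pi> $ i"
    and "left_jordan_decomposition P \<pi> Sinv L S"
    and Q_def: "Q = Sinv * D_mat L * S"
    and T_def: "T = centered_count \<alpha> \<pi> X"
  shows "(\<forall>r<m. (\<lambda>k. complex_of_real (prob_space.variance M (T r k) / real k))
             \<longlonglongrightarrow> complex_of_real (\<pi> $ r) * (1 + 2 * std_form m r Q r)) \<and>
         (\<forall>r<m. \<forall>s<m. r \<noteq> s \<longrightarrow>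
             (\<lambda>k. complex_of_real (covariance M (T r k) (T s k) / real k))
             \<longlonglongrightarrow> complex_of_real (\<pi> $ r) * std_form m r Q s
                 + complex_of_real (\<pi> $ s) * std_form m s Q r) \<and>
         (\<forall>r<m. \<forall>s<m.
             (\<lambda>k. complex_of_real (covariance M (T r k) (T s k) / real k))
             \<longlonglongrightarrow> Sigma_mat m \<pi> Q $$ (r, s))"
proof -
  \<comment> \<open>The entries of \<open>\<pi>\<close> sum to 1, so there is at least one state.
    Writing \<open>m = Suc n\<close> leaves an \<open>n\<close> by \<open>n\<close> block
    \<open>L\<close>.\<close>
  have "m \<noteq> 0"
  proof
    assume "m = 0"
    with assms(6) have "(\<Sum>i<0. \<pi> $ i) = 1" unfolding stationary_distribution_def by metis
    then show False by simp
  qed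
  then obtain n where m: "m = Suc n" by (cases m) auto
  interpret prob_space M by (rule assms(1))
  interpret stationary_jordan_chain M n \<alpha> P \<pi> X Sinv L S
  proof
    show "inj_on \<alpha> {..<Suc n}"
      using assms(2) unfolding m by (rule strict_mono_on_imp_inj_on)
    show "markov_chain M (Suc n) \<alpha> P X" using assms(3) unfolding m .
    then show "stochastic_mat (Suc n) P" by (simp only: markov_chain_def)
    show st: "stationary_distribution (Suc n) P \<pi>" using assms(6) unfolding m .
    show "\<P>(\<omega> in M. X 0 \<omega> = \<alpha> i) = \<pi> $ i" if "i < Suc n" for i
      by (rule assms(7)[unfolded m, THEN spec, THEN mp, OF that])
    show "irreducible_chain (Suc n) P" using assms(4) unfolding m .
    show "(\<Sum>i<Suc n. \<pi> $ i) = 1" "\<pi> \<in> carrier_vec (Suc n)"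
      using st by (simp_all only: stationary_distribution_def)
    show "left_jordan_decomposition P \<pi> Sinv L S" by (rule assms(8))
  qed
  have Q: "Q \<in> carrier_mat m m"
    unfolding Q_def m D_mat_eq
    by (rule mult_carrier_mat[OF mult_carrier_mat[OF Sinv_carrier block_diag_carrier] S_carrier])
      (rule mult_carrier_mat[OF L_carrier N_carrier])
  have Q_eq: "Q $$ (r, s) = R $$ (r, s) - complex_of_real (\<pi> $ s) / 2" if "r < m" "s < m" for r s
    unfolding Q_def using Q_entry that unfolding m .
  \<comment> \<open>The halves in \<open>Q $$ (r, s)\<close> and \<open>Q $$ (s, r)\<close>,
    weighted by \<open>\<pi> $ r\<close> and \<open>\<pi> $ s\<close>, add up to the term
    \<open>- \<pi> $ r * \<pi> $ s\<close> of \<open>rate r s\<close>.\<close>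
  have Sigma: "Sigma_mat m \<pi> Q $$ (r, s) = rate r s" if "r < m" "s < m" for r s
    unfolding Sigma_mat_entry[OF Q that] Q_eq[OF that] Q_eq[OF that(2,1)] rate_def
    by (simp add: algebra_simps)
  have cov: "(\<lambda>k. complex_of_real (covariance M (T r k) (T s k) / real k))
      \<longlonglongrightarrow> Sigma_mat m \<pi> Q $$ (r, s)" if "r < m" "s < m" for r s
    unfolding Sigma[OF that] T_def
    by (rule covariance_over_n_tendsto) (use that in \<open>simp_all add: m\<close>)
  have var: "variance (T r k) = covariance M (T r k) (T r k)" for r k
    by (simp add: covariance_def power2_eq_square)
  show ?thesis
  proof (intro conjI allI impI)
    fix r assume r: "r < m"
    show "(\<lambda>k. complex_of_real (variance (T r k) / real k))
        \<longlonglongrightarrow> complex_of_real (\<pi> $ r) * (1 + 2 * std_form m r Q r)"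
      \<comment> \<open>On the diagonal the two mixed terms coincide, which produces the factor
        2.\<close>
      using cov[OF r r] unfolding var Sigma_mat_entry[OF Q r r] std_form_eq_entry[OF Q r r]
      by (simp add: algebra_simps)
  next
    fix r s assume r: "r < m" and s: "s < m" and "r \<noteq> s"
    then show "(\<lambda>k. complex_of_real (covariance M (T r k) (T s k) / real k))
        \<longlonglongrightarrow> complex_of_real (\<pi> $ r) * std_form m r Q s
            + complex_of_real (\<pi> $ s) * std_form m s Q r"
      using cov[OF r s] Sigma_mat_entry[OF Q r s] std_form_eq_entry[OF Q r s]
        std_form_eq_entry[OF Q s r] by simp
  next
    fix r s assume "r < m" "s < m"
    then show "(\<lambda>k. complex_of_real (covariance M (T r k) (T s k) / real k))
        \<longlonglongrightarrow> Sigma_mat m \<pi> Q $$ (r, s)"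
      by (rule cov)
  qed
qed

end
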